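(* Assume $L_1\le L_2$, and let $\mathbf B=[\mathbf I_{L_1\times L_1},\mathbf 0]\in\{0,1\}^{L_1\times L_2}$, i.e. $b_{u,v}=1$ if $u=v$ and $b_{u,v}=0$ otherwise. Then $\mathbf B$ is an optimal path pairing matrix for the problem (P2) defined in the context; that is, for every feasible path pairing matrix $\mathbf B'$, the maximum of $C(\mathbf p,\mathbf t,\mathbf B)$ over all $(\mathbf p,\mathbf t)$ feasible for $\mathbf B$ is at least the maximum of $C(\mathbf p',\mathbf t',\mathbf B')$ over all $(\mathbf p',\mathbf t')$ feasible for $\mathbf B'$.
   Context: Let $L_1,L_2,L_3\ge 1$ be integers, let $\alpha_1,\dots,\alpha_{L_1}$ and $\beta_1,\dots,\beta_{L_2}$ be complex numbers with $|\alpha_1|\ge\cdots\ge|\alpha_{L_1}|$ and $|\beta_1|\ge\cdots\ge|\beta_{L_2}|$, let $c>0$ be a real constant, let $m_1^{\mathsf d},\dots,m_{L_3}^{\mathsf d}>0$, and let $P>0$. A feasible path pairing matrix is a matrix $\mathbf B=(b_{u,v})\in\{0,1\}^{L_1\times L_2}$ with at most one entry equal to $1$ in each row and in each column, and with at least one entry equal to $1$; the number of its entries equal to $1$ is denoted $S$ ($S$ is not fixed in advance and depends on $\mathbf B$). Enumerate the positions of the ones of $\mathbf B$ as $(u_1,v_1),\dots,(u_S,v_S)$ and set $m_s^{\mathsf r}=c\,|\alpha_{u_s}\beta_{v_s}|^2$ for $s=1,\dots,S$. Problem (P2): maximize over $\mathbf B$, $\mathbf p=(p_1^{\mathsf r},\dots,p_S^{\mathsf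 r},p_1^{\mathsf d},\dots,p_{L_3}^{\mathsf d})$ and $\mathbf t=(t_1,\dots,t_S)$ the function $$C(\mathbf p,\mathbf t,\mathbf B)=\sum_{s=1}^S\log\left(1+m_s^{\mathsf r}p_s^{\mathsf r}t_s^2\right)+\sum_{i=1}^{L_3}\log\left(1+m_i^{\mathsf d}p_i^{\mathsf d}\right),$$ where $\mathbf B$ is a feasible path pairing matrix and $(\mathbf p,\mathbf t)$ is feasible for $\mathbf B$, meaning $p_s^{\mathsf r}\ge0$ and $t_s\ge 0$ for all $s$, $p_i^{\mathsf d}\ge0$ for all $i$, $\sum_{s=1}^S p_s^{\mathsf r}+\sum_{i=1}^{L_3}p_i^{\mathsf d}=P$, and $\sum_{s=1}^S t_s=1$. *)

theory Defs
  imports Complex_Main "Jordan_Normal_Form.Matrix"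
begin

text \<open>All indices run from 0: rows \<open>u < L1\<close>, columns \<open>v < L2\<close>, and so on. Finite tuples of numbers
  are functions on \<open>nat\<close> of which only the values below the respective length matter.\<close>

definition ones :: "nat mat \<Rightarrow> (nat \<times> nat) set" where
  "ones B = {(u, v). u < dim_row B \<and> v < dim_col B \<and> B $$ (u, v) = 1}"

definition feasible_pairing :: "nat \<Rightarrow> nat \<Rightarrow> nat mat \<Rightarrow> bool" where
  "feasible_pairing L1 L2 B \<longleftrightarrow>
     B \<in> carrier_mat L1 L2 \<and>
     (\<forall>u<L1. \<forall>v<L2. B $$ (u, v) \<in> {0, 1}) \<and>
     (\<forall>u<L1. card {v. v < L2 \<and> B $$ (u, v) = 1} \<le> 1) \<and>
     (\<forall>v<L2. card {u. u < L1 \<and> B $$ (u, v) = 1} \<le> 1) \<and>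
     (\<exists>u<L1. \<exists>v<L2. B $$ (u, v) = 1)"

definition num_paths :: "nat mat \<Rightarrow> nat" where
  "num_paths B = card (ones B)"

definition enumerates :: "(nat \<Rightarrow> nat \<times> nat) \<Rightarrow> nat mat \<Rightarrow> bool" where
  "enumerates e B \<longleftrightarrow> bij_betw e {..<num_paths B} (ones B)"

definition gain :: "real \<Rightarrow> (nat \<Rightarrow> complex) \<Rightarrow> (nat \<Rightarrow> complex) \<Rightarrow> nat \<times> nat \<Rightarrow> real" where
  "gain c \<alpha> \<beta> = (\<lambda>(u, v). c * (cmod (\<alpha> u * \<beta> v))\<^sup>2)"

text \<open>An allocation \<open>(pr, pd, t)\<close> consists of the powers of the reflected paths, the powers of the
  direct paths, and the weights \<open>t\<close> of the reflected paths.\<close>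

type_synonym allocation = "(nat \<Rightarrow> real) \<times> (nat \<Rightarrow> real) \<times> (nat \<Rightarrow> real)"

definition feasible_alloc :: "nat \<Rightarrow> real \<Rightarrow> nat mat \<Rightarrow> allocation \<Rightarrow> bool" where
  "feasible_alloc L3 P B = (\<lambda>(pr, pd, t).
     (\<forall>s<num_paths B. 0 \<le> pr s \<and> 0 \<le> t s) \<and>
     (\<forall>i<L3. 0 \<le> pd i) \<and>
     (\<Sum>s<num_paths B. pr s) + (\<Sum>i<L3. pd i) = P \<and>
     (\<Sum>s<num_paths B. t s) = 1)"

text \<open>The logarithm is natural; another base only rescales the objective by a positive constant.\<close>

definition capacity ::
  "nat \<Rightarrow> (nat \<Rightarrow> complex) \<Rightarrow> (nat \<Rightarrow> complex) \<Rightarrow> real \<Rightarrow> (nat \<Rightarrow> real)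
     \<Rightarrow> nat mat \<Rightarrow> (nat \<Rightarrow> nat \<times> nat) \<Rightarrow> allocation \<Rightarrow> real" where
  "capacity L3 \<alpha> \<beta> c md B e = (\<lambda>(pr, pd, t).
     (\<Sum>s<num_paths B. ln (1 + gain c \<alpha> \<beta> (e s) * pr s * (t s)\<^sup>2)) +
     (\<Sum>i<L3. ln (1 + md i * pd i)))"

definition maximizer ::
  "nat \<Rightarrow> (nat \<Rightarrow> complex) \<Rightarrow> (nat \<Rightarrow> complex) \<Rightarrow> real \<Rightarrow> (nat \<Rightarrow> real) \<Rightarrow> real
     \<Rightarrow> nat mat \<Rightarrow> (nat \<Rightarrow> nat \<times> nat) \<Rightarrow> allocation \<Rightarrow> bool" where
  "maximizer L3 \<alpha> \<beta> c md P B e x \<longleftrightarrow>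
     is_arg_max (capacity L3 \<alpha> \<beta> c md B e) (feasible_alloc L3 P B) x"

text \<open>The comparison is required for all enumerations of the ones of both matrices, and it includes
  that both maxima are attained.\<close>

definition optimal_pairing ::
  "nat \<Rightarrow> nat \<Rightarrow> nat \<Rightarrow> (nat \<Rightarrow> complex) \<Rightarrow> (nat \<Rightarrow> complex) \<Rightarrow> real \<Rightarrow> (nat \<Rightarrow> real) \<Rightarrow> real
     \<Rightarrow> nat mat \<Rightarrow> bool" where
  "optimal_pairing L1 L2 L3 \<alpha> \<beta> c md P B \<longleftrightarrow>
     feasible_pairing L1 L2 B \<and>
     (\<forall>B' e e'. feasible_pairing L1 L2 B' \<and> enumerates e B \<and> enumerates e' B' \<longrightarrow>
        (\<exists>x x'. maximizer L3 \<alpha> \<beta> c md P B e x \<and> maximizer L3 \<alpha> \<beta> c md P B' e' x' \<and>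
           capacity L3 \<alpha> \<beta> c md B' e' x' \<le> capacity L3 \<alpha> \<beta> c md B e x))"

definition identity_pairing :: "nat \<Rightarrow> nat \<Rightarrow> nat mat" where
  "identity_pairing L1 L2 = mat L1 L2 (\<lambda>(u, v). if u = v then 1 else 0)"

end

theory Submission
  imports Defs "HOL-Analysis.Function_Topology"
begin

text \<open>Fix an allocation for \<open>B'\<close> and let path \<open>s\<close> carry the weight \<open>w\<^sub>s = c p\<^sub>s t\<^sub>s\<^sup>2\<close>. The product
  \<open>\<Prod>s. 1 + \<bar>\<alpha>\<^bsub>u s\<^esub>\<bar>\<^sup>2 \<bar>\<beta>\<^bsub>v s\<^esub>\<bar>\<^sup>2 w\<^sub>s\<close> does not decrease if, for two paths, the larger \<open>\<alpha>\<close> and the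
  larger \<open>\<beta>\<close> are moved to the path of larger weight. Hence it is at most the product in which the
  weights are matched with the pairs \<open>(\<alpha>\<^sub>k, \<beta>\<^sub>k)\<close> of the identity pairing; the remaining paths of
  the identity pairing get zero power. The maxima exist because the objective is continuous and
  the coordinates that matter range over a compact set.\<close>

section \<open>Rearrangement of weighted products\<close>

text \<open>Since \<open>min\<close> times \<open>max\<close> of two numbers is their product, the
  quadratic terms \<open>p * q\<close> of both sides agree, and only the linear terms have to be
  compared.\<close>

lemma two_point_rearrangement:
  fixes x1 x2 y1 y2 w1 w2 :: real
  assumes "0 \<le> x1" "0 \<le> x2" "0 \<le> y1" "0 \<le> y2" "0 \<le> w1" "w1 \<le> w2"
  shows "(1 + x1 * y1 * w1) * (1 + x2 * y2 * w2)
    \<le> (1 + min x1 x2 * min y1 y2 * w1) * (1 + max x1 x2 * max y1 y2 * w2)"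
proof -
  have "x1 * y1 * w1 + x2 * y2 * w2
    \<le> min x1 x2 * min y1 y2 * w1 + max x1 x2 * max y1 y2 * w2"
  \<comment> \<open>Where an order is wrong, right side minus left side factors into two nonnegative
    terms; with both orders right the sides coincide.\<close>
  proof (cases "x1 \<le> x2"; cases "y1 \<le> y2")
    assume "x1 \<le> x2" "\<not> y1 \<le> y2"
    then have "0 \<le> (y1 - y2) * (x2 * w2 - x1 * w1)"
      using assms by (intro mult_nonneg_nonneg) (auto intro: mult_mono)
    then show ?thesis
      using \<open>x1 \<le> x2\<close> \<open>\<not> y1 \<le> y2\<close> by (simp add: min_def max_def algebra_simps)
  next
    assume "\<not> x1 \<le> x2" "y1 \<le> y2"
    then have "0 \<le> (x1 - x2) * (y2 * w2 - y1 * w1)"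
      using assms by (intro mult_nonneg_nonneg) (auto intro: mult_mono)
    then show ?thesis
      using \<open>\<not> x1 \<le> x2\<close> \<open>y1 \<le> y2\<close> by (simp add: min_def max_def algebra_simps)
  next
    assume "\<not> x1 \<le> x2" "\<not> y1 \<le> y2"
    then have "0 \<le> (w2 - w1) * (x1 * y1 - x2 * y2)"
      using assms by (intro mult_nonneg_nonneg) (auto intro: mult_mono)
    then show ?thesis
      using \<open>\<not> x1 \<le> x2\<close> \<open>\<not> y1 \<le> y2\<close> by (simp add: min_def max_def algebra_simps)
  qed (simp add: min_def max_def)
  moreover have "min x1 x2 * max x1 x2 = x1 * x2" "min y1 y2 * max y1 y2 = y1 * y2"
    by (simp_all add: min_def max_def)
  then have "(min x1 x2 * min y1 y2 * w1) * (max x1 x2 * max y1 y2 * w2)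
    = (x1 * y1 * w1) * (x2 * y2 * w2)"
    by (metis (no_types, opaque_lifting) mult.assoc mult.left_commute)
  moreover have "(1 + p) * (1 + q) = 1 + (p + q) + p * q" for p q :: real
    by (simp add: algebra_simps)
  ultimately show ?thesis
    by (metis add_left_mono add_right_mono)
qed

text \<open>At most one transposition of values is needed; as it preserves the image, all indices
  stay distinct and in range.\<close>

lemma obtain_max_at:
  fixes u :: "'i \<Rightarrow> nat"
  assumes "inj_on u I" "s0 \<in> I" "s1 \<in> I"
  obtains u' where "inj_on u' I" "u' ` I = u ` I" "u' s0 = max (u s0) (u s1)"
    "u' s1 = min (u s0) (u s1)" "\<And>s. s \<noteq> s0 \<Longrightarrow> s \<noteq> s1 \<Longrightarrow> u' s = u s"
proof (cases "u s0 < u s1")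
  case True
  show ?thesis
  proof (rule that[of "u(s0 := u s1, s1 := u s0)"])
    show "inj_on (u(s0 := u s1, s1 := u s0)) I"
      using assms by (auto simp: inj_on_def)
    show "(u(s0 := u s1, s1 := u s0)) ` I = u ` I"
      using assms(2,3) by (auto simp: image_iff Bex_def)
  qed (use True in auto)
next
  case False
  then show ?thesis
    using assms by (intro that[of u]) auto
qed

text \<open>Larger indices carry smaller values of \<open>a\<close> and \<open>b\<close>, so moving
  both larger indices to the lighter \<open>s0\<close> is the two-point rearrangement; the other
  factors are unchanged and nonnegative.\<close>

lemma exchange_step:
  fixes a b :: "nat \<Rightarrow> real" and w :: "'i \<Rightarrow> real"
  assumes "finite I" "inj_on u I" "inj_on v I"
    and a: "antimono_on M a" "\<And>k. 0 \<le> a k" "u ` I \<subseteq> M"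
    and b: "antimono_on N b" "\<And>k. 0 \<le> b k" "v ` I \<subseteq> N"
    and w: "\<And>s. s \<in> I \<Longrightarrow> 0 \<le> w s"
    and s: "s0 \<in> I" "s1 \<in> I" "w s0 \<le> w s1"
  obtains u' v' where "inj_on u' I" "u' ` I = u ` I" "u' s0 = max (u s0) (u s1)"
    "inj_on v' I" "v' ` I = v ` I" "v' s0 = max (v s0) (v s1)"
    "(\<Prod>s\<in>I. 1 + a (u s) * b (v s) * w s) \<le> (\<Prod>s\<in>I. 1 + a (u' s) * b (v' s) * w s)"
proof -
  obtain u' where u': "inj_on u' I" "u' ` I = u ` I" "u' s0 = max (u s0) (u s1)"
    "u' s1 = min (u s0) (u s1)" "\<And>s. s \<noteq> s0 \<Longrightarrow> s \<noteq> s1 \<Longrightarrow> u' s = u s"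
    using obtain_max_at[OF assms(2) s(1,2)] by metis
  obtain v' where v': "inj_on v' I" "v' ` I = v ` I" "v' s0 = max (v s0) (v s1)"
    "v' s1 = min (v s0) (v s1)" "\<And>s. s \<noteq> s0 \<Longrightarrow> s \<noteq> s1 \<Longrightarrow> v' s = v s"
    using obtain_max_at[OF assms(3) s(1,2)] by metis
  have "(\<Prod>s\<in>I. 1 + a (u s) * b (v s) * w s) \<le> (\<Prod>s\<in>I. 1 + a (u' s) * b (v' s) * w s)"
  \<comment> \<open>This case may arise in the induction below, when the largest index already sits
    at \<open>s0\<close>.\<close>
  proof (cases "s0 = s1")
    case True
    then have "u' s = u s" "v' s = v s" for s
      using u' v' by (cases "s = s0"; auto)+
    then show ?thesis by simp
  next
    case False
    let ?J = "I - {s0} - {s1}"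
    have split: "prod f I = f s0 * f s1 * prod f ?J" for f :: "'i \<Rightarrow> real"
      using assms(1) s False
      by (simp add: prod.remove[of I s0] prod.remove[of "I - {s0}" s1])
    have mem: "u s0 \<in> M" "u s1 \<in> M" "v s0 \<in> N" "v s1 \<in> N"
      using s a(3) b(3) by auto
    have max_min: "a (u' s0) = min (a (u s0)) (a (u s1))" "a (u' s1) = max (a (u s0)) (a (u s1))"
      "b (v' s0) = min (b (v s0)) (b (v s1))" "b (v' s1) = max (b (v s0)) (b (v s1))"
      unfolding u'(3,4) v'(3,4)
      using monotone_onD[OF a(1) mem(1,2)] monotone_onD[OF a(1) mem(2,1)]
        monotone_onD[OF b(1) mem(3,4)] monotone_onD[OF b(1) mem(4,3)]
      by (auto simp: min_def max_def)
    have "(1 + a (u s0) * b (v s0) * w s0) * (1 + a (u s1) * b (v s1) * w s1)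
      \<le> (1 + a (u' s0) * b (v' s0) * w s0) * (1 + a (u' s1) * b (v' s1) * w s1)"
      unfolding max_min using a b w s by (intro two_point_rearrangement) auto
    moreover have "(\<Prod>s\<in>?J. 1 + a (u s) * b (v s) * w s) = (\<Prod>s\<in>?J. 1 + a (u' s) * b (v' s) * w s)"
      using u'(5) v'(5) by (intro prod.cong) auto
    moreover have "0 \<le> (\<Prod>s\<in>?J. 1 + a (u' s) * b (v' s) * w s)"
      using a b w by (intro prod_nonneg ballI add_nonneg_nonneg mult_nonneg_nonneg) auto
    ultimately show ?thesis
      unfolding split by (simp add: mult_right_mono)
  qed
  then show ?thesis
    using u' v' by (intro that[of u' v']) auto
qed

text \<open>Induction on \<open>I\<close>: two exchanges give the index \<open>s0\<close> of least weight the largest values of both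
  \<open>u\<close> and \<open>v\<close>, which are at least \<open>card I - 1\<close>; so \<open>s0\<close> may receive rank \<open>card I - 1\<close>.\<close>

lemma paired_product_le_ranked_product:
  fixes a b :: "nat \<Rightarrow> real" and w :: "'i \<Rightarrow> real"
  assumes "finite I" "inj_on u I" "inj_on v I"
    and "antimono_on {..<M} a" "\<And>k. 0 \<le> a k" "u ` I \<subseteq> {..<M}"
    and "antimono_on {..<N} b" "\<And>k. 0 \<le> b k" "v ` I \<subseteq> {..<N}"
    and "\<And>s. s \<in> I \<Longrightarrow> 0 \<le> w s"
  shows "\<exists>\<sigma>. bij_betw \<sigma> I {..<card I} \<and>
    (\<Prod>s\<in>I. 1 + a (u s) * b (v s) * w s) \<le> (\<Prod>s\<in>I. 1 + a (\<sigma> s) * b (\<sigma> s) * w s)"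
  using assms
proof (induction "card I" arbitrary: I u v)
  case 0
  then show ?case by (auto simp: bij_betw_def)
next
  case (Suc n)
  note fin = Suc.prems(1) and a = Suc.prems(4,5) and b = Suc.prems(7,8) and w = Suc.prems(10)
  have ne: "I \<noteq> {}"
    using Suc.hyps(2) by auto
  obtain s0 where s0: "s0 \<in> I" "\<And>s. s \<in> I \<Longrightarrow> w s0 \<le> w s"
    using ex_is_arg_min_if_finite[OF fin ne, of w] by (auto simp: is_arg_min_linorder)
  have Max_attained: "\<exists>s\<in>I. f s = Max (f ` I)" for f :: "'i \<Rightarrow> nat"
  proof -
    have "Max (f ` I) \<in> f ` I"
      using fin ne by (intro Max_in) auto
    then show ?thesis by (auto simp: image_iff)
  qed
  \<comment> \<open>The image consists of \<open>n + 1\<close> distinct naturals, so its largest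
    element is at least \<open>n\<close>.\<close>
  have card_le: "n \<le> Max (f ` I)" if "inj_on f I" for f :: "'i \<Rightarrow> nat"
    using card_le_Suc_Max[of "f ` I"] card_image[OF that] fin Suc.hyps(2) by simp
  obtain s1 where s1: "s1 \<in> I" "u s1 = Max (u ` I)"
    using Max_attained by blast
  obtain u1 v1 where 1: "inj_on u1 I" "u1 ` I = u ` I" "u1 s0 = max (u s0) (u s1)"
    "inj_on v1 I" "v1 ` I = v ` I" "v1 s0 = max (v s0) (v s1)"
    "(\<Prod>s\<in>I. 1 + a (u s) * b (v s) * w s) \<le> (\<Prod>s\<in>I. 1 + a (u1 s) * b (v1 s) * w s)"
    by (rule exchange_step[OF Suc.prems s0(1) s1(1) s0(2)[OF s1(1)]], assumption) (rule that)
  \<comment> \<open>The second exchange aims at \<open>v\<close>. It does not undo the first: it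
    replaces \<open>u1 s0\<close>, already the largest value of \<open>u\<close>, by a maximum with
    it.\<close>
  obtain s2 where s2: "s2 \<in> I" "v1 s2 = Max (v1 ` I)"
    using Max_attained by blast
  have sub1: "u1 ` I \<subseteq> {..<M}" "v1 ` I \<subseteq> {..<N}"
    using 1 Suc.prems by auto
  obtain u2 v2 where 2: "inj_on u2 I" "u2 ` I = u1 ` I" "u2 s0 = max (u1 s0) (u1 s2)"
    "inj_on v2 I" "v2 ` I = v1 ` I" "v2 s0 = max (v1 s0) (v1 s2)"
    "(\<Prod>s\<in>I. 1 + a (u1 s) * b (v1 s) * w s) \<le> (\<Prod>s\<in>I. 1 + a (u2 s) * b (v2 s) * w s)"
    by (rule exchange_step[OF fin 1(1,4) a sub1(1) b sub1(2) w s0(1) s2(1) s0(2)[OF s2(1)]], assumption) (rule that)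
  have "n \<le> u2 s0" "n \<le> v2 s0"
    using card_le[OF Suc.prems(2)] card_le[OF 1(4)] s1 s2 1 2 by auto
  \<comment> \<open>Antitonicity is known only below \<open>M\<close> and \<open>N\<close>; these
    bounds put \<open>n\<close> in range as well.\<close>
  moreover have lt: "u2 s0 < M" "v2 s0 < N"
    using 1 2 sub1 s0(1) by blast+
  ultimately have last: "a (u2 s0) \<le> a n" "b (v2 s0) \<le> b n"
    using monotone_onD[OF a(1), of n "u2 s0"] monotone_onD[OF b(1), of n "v2 s0"] by auto
  let ?J = "I - {s0}"
  have card_J: "card ?J = n"
    using Suc.hyps(2) fin s0(1) by simp
  have "u2 ` ?J \<subseteq> {..<M}" "v2 ` ?J \<subseteq> {..<N}"
    using sub1 unfolding 2(2,5)[symmetric] by auto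
  moreover have "inj_on u2 ?J" "inj_on v2 ?J"
    using 2 by (auto intro: inj_on_diff)
  \<comment> \<open>The other indices are re-ranked into \<open>{..<n}\<close>, so rank
    \<open>n\<close> is free for \<open>s0\<close> even if \<open>u2\<close> or \<open>v2\<close>
    takes the value \<open>n\<close> elsewhere.\<close>
  ultimately obtain \<sigma> where \<sigma>: "bij_betw \<sigma> ?J {..<n}"
    "(\<Prod>s\<in>?J. 1 + a (u2 s) * b (v2 s) * w s) \<le> (\<Prod>s\<in>?J. 1 + a (\<sigma> s) * b (\<sigma> s) * w s)"
    using Suc.hyps(1)[of ?J u2 v2] card_J fin a b w by auto
  define \<rho> where "\<rho> = \<sigma>(s0 := n)"
  have "bij_betw \<rho> (insert s0 ?J) (insert n {..<n})"
    unfolding \<rho>_def using \<sigma>(1) by (auto simp: bij_betw_def inj_on_def image_iff)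
  then have \<rho>: "bij_betw \<rho> I {..<card I}"
    using s0(1) Suc.hyps(2) by (simp add: insert_absorb lessThan_Suc[symmetric])
  have "(\<Prod>s\<in>I. 1 + a (u2 s) * b (v2 s) * w s)
    = (1 + a (u2 s0) * b (v2 s0) * w s0) * (\<Prod>s\<in>?J. 1 + a (u2 s) * b (v2 s) * w s)"
    using fin s0(1) by (rule prod.remove)
  also have "\<dots> \<le> (1 + a n * b n * w s0) * (\<Prod>s\<in>?J. 1 + a (\<sigma> s) * b (\<sigma> s) * w s)"
    using \<sigma>(2) last a b w s0(1)
    by (intro mult_mono add_left_mono prod_nonneg ballI add_nonneg_nonneg mult_nonneg_nonneg) auto
  also have "\<dots> = (1 + a (\<rho> s0) * b (\<rho> s0) * w s0) * (\<Prod>s\<in>?J. 1 + a (\<rho> s) * b (\<rho> s) * w s)"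
    by (auto simp: \<rho>_def intro!: prod.cong)
  also have "\<dots> = (\<Prod>s\<in>I. 1 + a (\<rho> s) * b (\<rho> s) * w s)"
    using fin s0(1) by (rule prod.remove[symmetric])
  finally show ?case
    using \<rho> 1(7) 2(7) by (intro exI[of _ \<rho>]) simp
qed

section \<open>Existence of maximizers\<close>

text \<open>Tychonoff: the box is a product of compact intervals, and the topology on functions is
  the product topology.\<close>

lemma compact_function_box: "compact {f :: nat \<Rightarrow> real. \<forall>i. f i \<in> {0..M}}"
proof -
  have "compactin (product_topology (\<lambda>_. euclidean) UNIV) (PiE UNIV (\<lambda>_ :: nat. {0..M}))"
    unfolding compactin_PiE by simp
  then show ?thesis
    by (simp add: euclidean_product_topology PiE_UNIV_domain Pi_def)
qed

lemma finite_ones: "finite (ones B)"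
  by (rule finite_subset[of _ "{..<dim_row B} \<times> {..<dim_col B}"]) (auto simp: ones_def)

lemma num_paths_pos:
  assumes "feasible_pairing L1 L2 B"
  shows "0 < num_paths B"
  using assms finite_ones[of B]
  by (auto simp: num_paths_def feasible_pairing_def ones_def card_gt_0_iff)

lemma closed_feasible_alloc: "closed {x. feasible_alloc L3 P B x}"
  unfolding feasible_alloc_def case_prod_beta imp_conv_disj
  by (intro closed_Collect_conj closed_Collect_all closed_Collect_disj closed_Collect_const
      closed_Collect_le closed_Collect_eq continuous_intros continuous_on_product_then_coordinatewise)

text \<open>Coordinates beyond the respective lengths are unconstrained, so the feasible set itself
  is not compact. The maximum is taken on its intersection with a box, and truncation shows that
  nothing is lost.\<close>

lemma maximizer_exists:
  assumes B: "feasible_pairing L1 L2 B" and "0 \<le> c" "0 \<le> P"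
    and md: "\<And>i. i < L3 \<Longrightarrow> 0 \<le> md i"
  shows "\<exists>x. maximizer L3 \<alpha> \<beta> c md P B e x"
proof -
  \<comment> \<open>Powers are at most \<open>P\<close> and each \<open>t s\<close> is at most
    \<open>1\<close>; a single bound serves all three components.\<close>
  define Q where "Q = {f :: nat \<Rightarrow> real. \<forall>i. f i \<in> {0..max 1 P}}"
  define K where "K = {x. feasible_alloc L3 P B x} \<inter> (Q \<times> Q \<times> Q)"
  define cut :: "nat \<Rightarrow> (nat \<Rightarrow> real) \<Rightarrow> nat \<Rightarrow> real" where
    "cut n f = (\<lambda>i. if i < n then f i else 0)" for n f
  let ?n = "num_paths B" and ?C = "capacity L3 \<alpha> \<beta> c md B e"
  have gain: "0 \<le> gain c \<alpha> \<beta> q" for q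
    using \<open>0 \<le> c\<close> by (simp add: gain_def case_prod_beta)
  have "compact K"
    unfolding K_def Q_def
    by (intro closed_Int_compact closed_feasible_alloc compact_Times compact_function_box)
  moreover have "K \<noteq> {}"
  proof -
    \<comment> \<open>Everything goes to path \<open>0\<close>, which exists because a feasible
      matrix contains a one.\<close>
    let ?z = "\<lambda>r i :: nat. if i = 0 then r else (0 :: real)"
    have "(?z P, \<lambda>_. 0, ?z 1) \<in> K"
      using num_paths_pos[OF B] \<open>0 \<le> P\<close>
      by (auto simp: K_def Q_def feasible_alloc_def sum.delta)
    then show ?thesis by blast
  qed
  moreover have "continuous_on K ?C"
  proof -
    \<comment> \<open>On the box all coordinates are nonnegative, so each argument of
      \<open>ln\<close> is at least \<open>1\<close>, where \<open>ln\<close> is continuous.\<close>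
    have "1 + gain c \<alpha> \<beta> (e s) * fst x s * (snd (snd x) s)\<^sup>2 \<noteq> 0" if "x \<in> K" for x s
    proof -
      have "0 \<le> fst x s" using that by (auto simp: K_def Q_def)
      then have "0 \<le> gain c \<alpha> \<beta> (e s) * fst x s * (snd (snd x) s)\<^sup>2"
        using gain by (intro mult_nonneg_nonneg) auto
      then show ?thesis by linarith
    qed
    moreover have "1 + md i * fst (snd x) i \<noteq> 0" if "x \<in> K" "i < L3" for x i
    proof -
      have "0 \<le> fst (snd x) i" using that by (auto simp: K_def Q_def)
      then have "0 \<le> md i * fst (snd x) i" using md[OF that(2)] by simp
      then show ?thesis by linarith
    qed
    ultimately show ?thesis
      unfolding capacity_def case_prod_beta
      by (intro continuous_intros continuous_on_product_then_coordinatewise) auto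
  qed
  ultimately obtain x where x: "x \<in> K" "\<And>y. y \<in> K \<Longrightarrow> ?C y \<le> ?C x"
    using continuous_attains_sup[of K ?C] by blast
  \<comment> \<open>Truncating \<open>y\<close> to the coordinates that matter puts it into
    \<open>K\<close> without changing the objective.\<close>
  have "?C y \<le> ?C x" if y: "feasible_alloc L3 P B y" for y
  proof -
    obtain pr pd t where y_eq: "y = (pr, pd, t)"
      by (cases y)
    let ?y = "(cut ?n pr, cut L3 pd, cut ?n t)"
    note feas = y[unfolded feasible_alloc_def y_eq prod.case]
    have sum_cut: "sum (cut n f) {..<n} = sum f {..<n}" for n f
      by (simp add: cut_def)
    \<comment> \<open>Both sums are nonnegative and add up to \<open>P\<close>, hence no single
      power exceeds \<open>P\<close>.\<close>
    have pos: "0 \<le> sum pr {..<?n}" "0 \<le> sum pd {..<L3}"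
      using feas by (auto intro: sum_nonneg)
    have "cut ?n pr \<in> Q"
      unfolding Q_def cut_def using feas pos member_le_sum[of _ "{..<?n}" pr]
      by (fastforce simp: le_max_iff_disj)
    moreover have "cut L3 pd \<in> Q"
      unfolding Q_def cut_def using feas pos member_le_sum[of _ "{..<L3}" pd]
      by (fastforce simp: le_max_iff_disj)
    moreover have "cut ?n t \<in> Q"
      unfolding Q_def cut_def using feas member_le_sum[of _ "{..<?n}" t]
      by (fastforce simp: le_max_iff_disj)
    moreover have "feasible_alloc L3 P B ?y"
      using feas by (simp add: feasible_alloc_def sum_cut) (simp add: cut_def)
    ultimately have "?C ?y \<le> ?C x"
      by (intro x(2)) (simp add: K_def)
    moreover have "?C ?y = ?C y"
      by (simp add: capacity_def y_eq cut_def)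
    ultimately show ?thesis by simp
  qed
  then show ?thesis
    using x(1) by (auto simp: maximizer_def is_arg_max_linorder K_def)
qed

section \<open>Structure of pairing matrices\<close>

lemma feasible_identity_pairing:
  assumes "1 \<le> L1" "L1 \<le> L2"
  shows "feasible_pairing L1 L2 (identity_pairing L1 L2)"
proof -
  have entry: "identity_pairing L1 L2 $$ (u, v) = (if u = v then 1 else 0)" if "u < L1" "v < L2" for u v
    using that by (simp add: identity_pairing_def)
  have "card {v. v < L2 \<and> identity_pairing L1 L2 $$ (u, v) = 1} \<le> 1" if "u < L1" for u
  proof -
    have "{v. v < L2 \<and> identity_pairing L1 L2 $$ (u, v) = 1} \<subseteq> {u}"
      using that by (auto simp: entry split: if_splits)
    from card_mono[OF _ this] show ?thesis by simp
  qed
  moreover have "card {u. u < L1 \<and> identity_pairing L1 L2 $$ (u, v) = 1} \<le> 1" if "v < L2" for v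
  proof -
    have "{u. u < L1 \<and> identity_pairing L1 L2 $$ (u, v) = 1} \<subseteq> {v}"
      using that by (auto simp: entry split: if_splits)
    from card_mono[OF _ this] show ?thesis by simp
  qed
  moreover have "\<exists>u<L1. \<exists>v<L2. identity_pairing L1 L2 $$ (u, v) = 1"
    using assms entry[of 0 0] by (intro exI[of _ 0] conjI) auto
  ultimately show ?thesis
    using assms by (simp add: feasible_pairing_def) (simp add: identity_pairing_def)
qed

lemma ones_identity_pairing:
  assumes "L1 \<le> L2"
  shows "ones (identity_pairing L1 L2) = (\<lambda>k. (k, k)) ` {..<L1}"
  using assms by (auto simp: ones_def identity_pairing_def split: if_splits)

lemma num_paths_identity_pairing:
  assumes "L1 \<le> L2"
  shows "num_paths (identity_pairing L1 L2) = L1"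
  by (simp add: num_paths_def ones_identity_pairing[OF assms] card_image inj_on_def)

text \<open>A row or column with at most one one determines that one, so the paths use distinct rows
  and distinct columns. This is the injectivity that the ranking lemma asks for.\<close>

lemma feasible_pairing_inj_on:
  assumes "feasible_pairing L1 L2 B"
  shows "inj_on fst (ones B)" "inj_on snd (ones B)"
    "fst ` ones B \<subseteq> {..<L1}" "snd ` ones B \<subseteq> {..<L2}"
proof -
  have dim: "dim_row B = L1" "dim_col B = L2"
    using assms by (auto simp: feasible_pairing_def)
  have row: "card {v. v < L2 \<and> B $$ (u, v) = 1} \<le> 1" if "u < L1" for u
    using assms that by (simp add: feasible_pairing_def)
  have col: "card {u. u < L1 \<and> B $$ (u, v) = 1} \<le> 1" if "v < L2" for v
    using assms that by (simp add: feasible_pairing_def)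
  show "inj_on fst (ones B)"
    using row by (auto simp: inj_on_def ones_def dim card_le_Suc0_iff_eq)
  show "inj_on snd (ones B)"
    using col by (auto simp: inj_on_def ones_def dim card_le_Suc0_iff_eq)
  show "fst ` ones B \<subseteq> {..<L1}" "snd ` ones B \<subseteq> {..<L2}"
    by (auto simp: ones_def dim)
qed

lemma antimono_on_cmod_square:
  assumes "antimono_on A (\<lambda>k. cmod (z k))"
  shows "antimono_on A (\<lambda>k. (cmod (z k))\<^sup>2)"
  using assms by (auto simp: monotone_on_def intro: power_mono)

section \<open>Comparison with the identity pairing\<close>

text \<open>The allocation is transported: path \<open>s\<close> hands its power and its
  \<open>t s\<close> to the diagonal path given by the rank of its weight, and the direct powers are
  kept.\<close>

lemma identity_pairing_dominates:
  assumes \<alpha>: "antimono_on {..<L1} (\<lambda>u. cmod (\<alpha> u))"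
    and \<beta>: "antimono_on {..<L2} (\<lambda>v. cmod (\<beta> v))"
    and "0 \<le> c" "L1 \<le> L2"
    and B': "feasible_pairing L1 L2 B'"
    and e: "enumerates e (identity_pairing L1 L2)" and e': "enumerates e' B'"
    and x': "feasible_alloc L3 P B' x'"
  shows "\<exists>x. feasible_alloc L3 P (identity_pairing L1 L2) x \<and>
    capacity L3 \<alpha> \<beta> c md B' e' x' \<le> capacity L3 \<alpha> \<beta> c md (identity_pairing L1 L2) e x"
proof -
  obtain pr pd t where x'_eq: "x' = (pr, pd, t)"
    by (cases x')
  let ?n = "num_paths B'"
  define a where "a = (\<lambda>k. (cmod (\<alpha> k))\<^sup>2)"
  define b where "b = (\<lambda>k. (cmod (\<beta> k))\<^sup>2)"
  \<comment> \<open>The constant \<open>c\<close> is absorbed into the weight, so that each term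
    splits into \<open>a\<close>, \<open>b\<close> and \<open>w\<close>.\<close>
  define w where "w s = c * (pr s * (t s)\<^sup>2)" for s
  note feas = x'[unfolded feasible_alloc_def x'_eq prod.case]
  have w: "0 \<le> w s" if "s < ?n" for s
    using feas that \<open>0 \<le> c\<close> by (simp add: w_def)
  have bij': "bij_betw e' {..<?n} (ones B')"
    using e' by (simp add: enumerates_def)
  note inj = feasible_pairing_inj_on[OF B']
  have img: "inj_on e' {..<?n}" "e' ` {..<?n} = ones B'"
    using bij' by (auto simp: bij_betw_def)
  have u: "inj_on (fst \<circ> e') {..<?n}" "(fst \<circ> e') ` {..<?n} \<subseteq> {..<L1}"
    unfolding image_comp[symmetric] img(2) using img inj by (auto intro!: comp_inj_on)
  have v: "inj_on (snd \<circ> e') {..<?n}" "(snd \<circ> e') ` {..<?n} \<subseteq> {..<L2}"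
    unfolding image_comp[symmetric] img(2) using img inj by (auto intro!: comp_inj_on)
  \<comment> \<open>The paths occupy distinct rows; hence every rank below \<open>?n\<close> is a
    diagonal position of the identity pairing.\<close>
  have "?n \<le> L1"
    using card_inj_on_le[OF u] by simp
  obtain \<sigma> where \<sigma>: "bij_betw \<sigma> {..<?n} {..<?n}"
    and le: "(\<Prod>s<?n. 1 + a (fst (e' s)) * b (snd (e' s)) * w s)
      \<le> (\<Prod>s<?n. 1 + a (\<sigma> s) * b (\<sigma> s) * w s)"
    using paired_product_le_ranked_product[OF _ u(1) v(1), of L1 a L2 b w] u v w
      antimono_on_cmod_square[OF \<alpha>] antimono_on_cmod_square[OF \<beta>]
    by (auto simp: a_def b_def)
  \<comment> \<open>The enumeration \<open>e\<close> is arbitrary, so the place of each diagonal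
    position in it has to be looked up.\<close>
  have "bij_betw e {..<L1} ((\<lambda>k. (k, k)) ` {..<L1})"
    using e by (simp add: enumerates_def num_paths_identity_pairing[OF \<open>L1 \<le> L2\<close>]
        ones_identity_pairing[OF \<open>L1 \<le> L2\<close>])
  then have "e ` {..<L1} = (\<lambda>k. (k, k)) ` {..<L1}"
    by (rule bij_betw_imp_surj_on)
  then have inv_e: "\<exists>j<L1. e j = (k, k)" if "k < L1" for k
    using that by (metis (no_types, lifting) image_eqI imageE lessThan_iff)
  have "\<exists>j<L1. e j = (\<sigma> s, \<sigma> s)" if "s < ?n" for s
    using bij_betwE[OF \<sigma>] that \<open>?n \<le> L1\<close> by (intro inv_e) force
  then obtain \<tau> where \<tau>: "\<And>s. s < ?n \<Longrightarrow> \<tau> s < L1 \<and> e (\<tau> s) = (\<sigma> s, \<sigma> s)"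
    by metis
  have inj_\<tau>: "inj_on \<tau> {..<?n}"
  proof (rule inj_onI)
    fix s s' assume s: "s \<in> {..<?n}" "s' \<in> {..<?n}" "\<tau> s = \<tau> s'"
    then have "\<sigma> s = \<sigma> s'"
      using \<tau>[of s] \<tau>[of s'] by simp
    then show "s = s'"
      using bij_betw_imp_inj_on[OF \<sigma>] s by (auto dest: inj_onD)
  qed
  \<comment> \<open>Off the image of \<open>\<tau>\<close> the default \<open>0\<close> adds nothing
    to either budget and turns each logarithm into \<open>ln 1\<close>, so sums over
    \<open>L1\<close> paths reduce to sums over \<open>?n\<close>.\<close>
  define lift :: "(nat \<Rightarrow> real) \<Rightarrow> nat \<Rightarrow> real" where
    "lift f j = (if j \<in> \<tau> ` {..<?n} then f (inv_into {..<?n} \<tau> j) else 0)" for f j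
  have lift_\<tau>: "lift f (\<tau> s) = f s" if "s < ?n" for f s
    using that inj_\<tau> by (simp add: lift_def)
  have sum_\<tau>: "sum g {..<L1} = (\<Sum>s<?n. g (\<tau> s))"
    if "\<And>j. j \<notin> \<tau> ` {..<?n} \<Longrightarrow> g j = 0" for g :: "nat \<Rightarrow> real"
  proof -
    have "sum g {..<L1} = sum g (\<tau> ` {..<?n})"
      using \<tau> that by (intro sum.mono_neutral_right) auto
    then show ?thesis
      using inj_\<tau> by (simp add: sum.reindex)
  qed
  have sum_lift: "sum (lift f) {..<L1} = sum f {..<?n}" for f
  proof -
    have "sum (lift f) {..<L1} = (\<Sum>s<?n. lift f (\<tau> s))"
      by (rule sum_\<tau>) (simp add: lift_def)
    also have "\<dots> = sum f {..<?n}"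
      by (simp add: lift_\<tau>)
    finally show ?thesis .
  qed
  have lift_nonneg: "0 \<le> lift f j" if "\<And>s. s < ?n \<Longrightarrow> 0 \<le> f s" for f j
  proof (cases "j \<in> \<tau> ` {..<?n}")
    case True
    then show ?thesis using that lift_\<tau> by auto
  qed (simp add: lift_def)
  let ?x = "(lift pr, pd, lift t)"
  have "feasible_alloc L3 P (identity_pairing L1 L2) ?x"
    using feas lift_nonneg
    by (simp add: feasible_alloc_def num_paths_identity_pairing[OF \<open>L1 \<le> L2\<close>] sum_lift)
  moreover have "capacity L3 \<alpha> \<beta> c md B' e' x' \<le> capacity L3 \<alpha> \<beta> c md (identity_pairing L1 L2) e ?x"
  proof -
    \<comment> \<open>Positivity of the factors turns the sum of logarithms into the logarithm of a
      product, to which the ranked bound applies.\<close>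
    have factor_pos: "0 < 1 + a k * b l * w s" if "s < ?n" for k l s
    proof -
      have "0 \<le> a k * b l * w s"
        using w[OF that] by (simp add: a_def b_def)
      then show ?thesis by linarith
    qed
    have ln_factors: "ln (\<Prod>s<?n. 1 + a (f s) * b (g s) * w s)
      = (\<Sum>s<?n. ln (1 + a (f s) * b (g s) * w s))" for f g
      using factor_pos by (intro ln_prod) (auto simp: less_le)
    have gain: "gain c \<alpha> \<beta> q * pr s * (t s)\<^sup>2 = a (fst q) * b (snd q) * w s" for q s
      by (simp add: gain_def case_prod_beta a_def b_def w_def norm_mult power_mult_distrib)
    have "(\<Sum>s<?n. ln (1 + gain c \<alpha> \<beta> (e' s) * pr s * (t s)\<^sup>2))
      = ln (\<Prod>s<?n. 1 + a (fst (e' s)) * b (snd (e' s)) * w s)"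
      by (simp add: gain ln_factors)
    also have "\<dots> \<le> ln (\<Prod>s<?n. 1 + a (\<sigma> s) * b (\<sigma> s) * w s)"
      using le factor_pos by (intro ln_mono) (auto intro!: prod_pos)
    also have "\<dots> = (\<Sum>s<?n. ln (1 + gain c \<alpha> \<beta> (e (\<tau> s)) * lift pr (\<tau> s) * (lift t (\<tau> s))\<^sup>2))"
      unfolding ln_factors using \<tau> lift_\<tau> gain by (intro sum.cong) auto
    also have "\<dots> = (\<Sum>j<L1. ln (1 + gain c \<alpha> \<beta> (e j) * lift pr j * (lift t j)\<^sup>2))"
      by (subst sum_\<tau>) (auto simp: lift_def)
    finally show ?thesis
      by (simp add: capacity_def x'_eq num_paths_identity_pairing[OF \<open>L1 \<le> L2\<close>])
  qed
  ultimately show ?thesis by blast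
qed

theorem proposition2:
  fixes L1 L2 L3 :: nat
    and \<alpha> \<beta> :: "nat \<Rightarrow> complex"
    and c P :: real
    and md :: "nat \<Rightarrow> real"
  assumes "1 \<le> L1" and "1 \<le> L2" and "1 \<le> L3"
    and "antimono_on {..<L1} (\<lambda>u. cmod (\<alpha> u))"
    and "antimono_on {..<L2} (\<lambda>v. cmod (\<beta> v))"
    and "0 < c"
    and "\<And>i. i < L3 \<Longrightarrow> 0 < md i"
    and "0 < P"
    and "L1 \<le> L2"
  shows "optimal_pairing L1 L2 L3 \<alpha> \<beta> c md P (identity_pairing L1 L2)"
  unfolding optimal_pairing_def
proof (intro conjI allI impI; (elim conjE)?)
  show id: "feasible_pairing L1 L2 (identity_pairing L1 L2)"
    using assms by (intro feasible_identity_pairing)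
  fix B' e e'
  assume B': "feasible_pairing L1 L2 B'"
    and e: "enumerates e (identity_pairing L1 L2)" and e': "enumerates e' B'"
  have "\<exists>x. maximizer L3 \<alpha> \<beta> c md P B e x" if "feasible_pairing L1 L2 B" for B e
    using assms that by (intro maximizer_exists) (auto intro: less_imp_le)
  then obtain x x' where x: "maximizer L3 \<alpha> \<beta> c md P (identity_pairing L1 L2) e x"
    and x': "maximizer L3 \<alpha> \<beta> c md P B' e' x'"
    using id B' by metis
  \<comment> \<open>The maximizer for \<open>B'\<close> is carried to a feasible \<open>y\<close>
    for the identity pairing, and the maximizer \<open>x\<close> is at least as good as
    \<open>y\<close>.\<close>
  obtain y where "feasible_alloc L3 P (identity_pairing L1 L2) y"
    "capacity L3 \<alpha> \<beta> c md B' e' x' \<le> capacity L3 \<alpha> \<beta> c md (identity_pairing L1 L2) e y"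
    using identity_pairing_dominates[OF assms(4,5) less_imp_le[OF assms(6)] assms(9) B' e e'] x'
    unfolding maximizer_def is_arg_max_def by blast
  then have "capacity L3 \<alpha> \<beta> c md B' e' x' \<le> capacity L3 \<alpha> \<beta> c md (identity_pairing L1 L2) e x"
    using x by (metis maximizer_def is_arg_max_linorder order_trans)
  then show "\<exists>x x'. maximizer L3 \<alpha> \<beta> c md P (identity_pairing L1 L2) e x \<and>
      maximizer L3 \<alpha> \<beta> c md P B' e' x' \<and>
      capacity L3 \<alpha> \<beta> c md B' e' x' \<le> capacity L3 \<alpha> \<beta> c md (identity_pairing L1 L2) e x"
    using x x' by blast
qed

end
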